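(* Let $(X,d)$ be a separable metric space and let $\phi\colon X\to X$ be a continuous map. Then there exists a complete Lyapunov function for $\phi$.
   Context: A continuous map $\phi\colon X\to X$ is identified with the discrete-time topological semiflow $\Phi\colon\mathbb{Z}_{\ge0}\times X\to X$, $\Phi(t,x)=\phi^t(x)$. Chains. An error function is a continuous function $\varepsilon\colon X\to\mathbb{R}_{>0}$. For $x,y\in X$, an error function $\varepsilon$, and $T\in\mathbb{Z}_{>0}$, an $(\varepsilon,T)$-chain for $\Phi$ from $x$ to $y$ consists of an integer $k\ge1$, points $x_0,\dots,x_k\in X$ and integer times $t_0,\dots,t_{k-1}\ge T$ with $x_0=x$, $x_k=y$ and $d(\Phi(t_j,x_j),x_{j+1})<\varepsilon(\Phi(t_j,x_j))$ for $j\in\{0,\dots,k-1\}$. A point $x$ is chain recurrent for $\Phi$ if, for each error function $\varepsilon$ and each $T\in\mathbb{Z}_{>0}$, there is an $(\varepsilon,T)$-chain from $x$ to itself; $\mathrm{ChRec}(\Phi)$ is the set of chain recurrent points. Points $x,y$ are chain equivalent for $\Phi$ if, for each error function $\varepsilon$ and each $T\in\mathbb{Z}_{>0}$, there are $(\varepsilon,T)$-chains from $x$ to $y$ and from $y$ to $x$. A complete Lyapunov function for $\phi$ (that is, for $\Phi$) is a continuous function $L\colon X\to[0,1]$ such that: (i) $L(\Phi(t_2,x))\le L(\Phi(t_1,x))$ for $x\in X$ and $t_1,t_2\in\mathbb{Z}_{\ge0}$ with $t_1<t_2$; (ii) $L(\Phi(t,x))<L(x)$ for $x\in X\setminus\mathrm{ChRec}(\Phi)$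 and $t\in\mathbb{Z}_{>0}$; (iii) $L(\Phi(t,x))=L(x)$ for $x\in\mathrm{ChRec}(\Phi)$ and $t\in\mathbb{Z}_{\ge0}$; (iv) points $x,y\in\mathrm{ChRec}(\Phi)$ are chain equivalent if and only if $L(x)=L(y)$. *)

theory Defs
  imports "HOL-Analysis.Analysis"
begin

text \<open>The metric space is the carrier of a type of class \<^class>\<open>metric_space\<close>.
  Chains, chain recurrence and Lyapunov functions are defined for an arbitrary time evolution
  \<open>\<Phi> t x\<close> with \<open>t\<close> a natural number; the semiflow laws play no role in the
  definitions, and they hold for \<open>iterates \<phi>\<close>, the semiflow identified with \<open>\<phi>\<close>.\<close>

definition iterates :: "('a \<Rightarrow> 'a) \<Rightarrow> nat \<Rightarrow> 'a \<Rightarrow> 'a" where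
  "iterates \<phi> t x = (\<phi> ^^ t) x"

definition error_function :: "('a::metric_space \<Rightarrow> real) \<Rightarrow> bool" where
  "error_function \<epsilon> \<longleftrightarrow> continuous_on UNIV \<epsilon> \<and> (\<forall>x. 0 < \<epsilon> x)"

text \<open>In a chain with \<open>k\<close> steps only \<open>p 0, \<dots>, p k\<close> and
  \<open>t 0, \<dots>, t (k - 1)\<close> matter; later values of the sequences are unconstrained.\<close>

definition chain_from_to ::
  "(nat \<Rightarrow> 'a::metric_space \<Rightarrow> 'a) \<Rightarrow> ('a \<Rightarrow> real) \<Rightarrow> nat \<Rightarrow> 'a \<Rightarrow> 'a \<Rightarrow> bool" where
  "chain_from_to \<Phi> \<epsilon> T x y \<longleftrightarrow>
     (\<exists>(k::nat) (p :: nat \<Rightarrow> 'a) (t :: nat \<Rightarrow> nat).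
        1 \<le> k \<and> p 0 = x \<and> p k = y \<and>
        (\<forall>j<k. T \<le> t j \<and> dist (\<Phi> (t j) (p j)) (p (Suc j)) < \<epsilon> (\<Phi> (t j) (p j))))"

definition chain_recurrent_set :: "(nat \<Rightarrow> 'a::metric_space \<Rightarrow> 'a) \<Rightarrow> 'a set" where
  "chain_recurrent_set \<Phi> =
     {x. \<forall>\<epsilon> T. error_function \<epsilon> \<and> 0 < T \<longrightarrow> chain_from_to \<Phi> \<epsilon> T x x}"

definition chain_equivalent :: "(nat \<Rightarrow> 'a::metric_space \<Rightarrow> 'a) \<Rightarrow> 'a \<Rightarrow> 'a \<Rightarrow> bool" where
  "chain_equivalent \<Phi> x y \<longleftrightarrow>
     (\<forall>\<epsilon> T. error_function \<epsilon> \<and> 0 < T \<longrightarrow>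
        chain_from_to \<Phi> \<epsilon> T x y \<and> chain_from_to \<Phi> \<epsilon> T y x)"

definition complete_lyapunov_function ::
  "(nat \<Rightarrow> 'a::metric_space \<Rightarrow> 'a) \<Rightarrow> ('a \<Rightarrow> real) \<Rightarrow> bool" where
  "complete_lyapunov_function \<Phi> L \<longleftrightarrow>
     continuous_on UNIV L \<and> (\<forall>x. L x \<in> {0..1}) \<and>
     (\<forall>x t1 t2. t1 < t2 \<longrightarrow> L (\<Phi> t2 x) \<le> L (\<Phi> t1 x)) \<and>
     (\<forall>x t. x \<notin> chain_recurrent_set \<Phi> \<and> 0 < t \<longrightarrow> L (\<Phi> t x) < L x) \<and>
     (\<forall>x t. x \<in> chain_recurrent_set \<Phi> \<longrightarrow> L (\<Phi> t x) = L x) \<and>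
     (\<forall>x\<in>chain_recurrent_set \<Phi>. \<forall>y\<in>chain_recurrent_set \<Phi>.
        chain_equivalent \<Phi> x y \<longleftrightarrow> L x = L y)"

end

theory Submission
  imports Defs
begin

text \<open>
  For an error function \<open>\<epsilon>\<close> and \<open>T > 0\<close>, let \<open>U\<close> be the open set of points
  that can be reached from a point \<open>x\<close> by \<open>(\<epsilon>, T)\<close>-chains, and let \<open>C\<close> be the
  closure of the union of the sets \<open>\<phi>\<^sup>t U\<close> with \<open>t \<ge> T\<close>. Then \<open>C\<close> is forward
  invariant and contained in \<open>U\<close>, and if \<open>f\<close> is a Urysohn function that is 1 on \<open>C\<close> and
  0 off \<open>U\<close>, then \<open>1 - f \<cdot> (f \<circ> \<phi>) \<cdots> (f \<circ> \<phi>\<^sup>T\<^sup>-\<^sup>1)\<close> does not increase along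
  orbits. Chain recurrent points with an orbit meeting \<open>U\<close> lie in \<open>C\<close>, hence on chain recurrent
  points this function takes only the values 0 and 1, and it is constant on orbits and on chain
  classes. Functions of this kind, composed with iterates of \<open>\<phi>\<close>, separate \<open>x\<close> from
  \<open>\<phi> x\<close> if \<open>x\<close> is not chain recurrent, and separate inequivalent chain recurrent points.
  By separability countably many of them do; they are combined with weights \<open>2 / 3\<^sup>n\<^sup>+\<^sup>1\<close>,
  which keeps 0-1 sequences apart.
\<close>

section \<open>Chains\<close>

lemma iterates_0 [simp]: "iterates \<phi> 0 x = x"
  by (simp add: iterates_def)

lemma iterates_add: "iterates \<phi> s (iterates \<phi> t x) = iterates \<phi> (s + t) x"
  by (simp add: iterates_def funpow_add)

lemma iterates_Suc: "iterates \<phi> (Suc t) x = iterates \<phi> t (\<phi> x)"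
  by (simp add: iterates_def funpow_swap1)

lemma continuous_on_iterates:
  assumes "continuous_on UNIV \<phi>"
  shows "continuous_on UNIV (iterates \<phi> t)"
proof (induction t)
  case (Suc t)
  have "iterates \<phi> (Suc t) = iterates \<phi> t \<circ> \<phi>"
    by (auto simp: iterates_Suc)
  then show ?case
    using assms Suc by (metis continuous_on_compose continuous_on_subset subset_UNIV)
qed (simp add: iterates_def)

lemma chain_single:
  assumes "T \<le> t" "dist (\<Phi> t x) y < \<epsilon> (\<Phi> t x)"
  shows "chain_from_to \<Phi> \<epsilon> T x y"
  unfolding chain_from_to_def
  by (rule exI[of _ 1], rule exI[of _ "\<lambda>j. if j = 0 then x else y"], rule exI[of _ "\<lambda>_. t"])
    (use assms in auto)

lemma chain_append:
  assumes "chain_from_to \<Phi> \<epsilon> T x y" "T \<le> s" "dist (\<Phi> s y) z < \<epsilon> (\<Phi> s y)"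
  shows "chain_from_to \<Phi> \<epsilon> T x z"
proof -
  obtain k p t where *: "1 \<le> k" "p 0 = x" "p k = y"
    "\<And>j. j < k \<Longrightarrow> T \<le> t j \<and> dist (\<Phi> (t j) (p j)) (p (Suc j)) < \<epsilon> (\<Phi> (t j) (p j))"
    using assms(1) unfolding chain_from_to_def by blast
  show ?thesis
    unfolding chain_from_to_def
    by (rule exI[of _ "Suc k"], rule exI[of _ "p(Suc k := z)"], rule exI[of _ "t(k := s)"])
      (use * assms(2,3) in \<open>auto simp: less_Suc_eq\<close>)
qed

text \<open>Induction along the chain keeps all its points in \<open>insert x S\<close>. The start
  \<open>x\<close> is treated separately because it may lie outside the set that chain steps lead
  into.\<close>

lemma chain_last_step:
  assumes "chain_from_to \<Phi> \<epsilon> T x y"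
    and step: "\<And>q t z. q \<in> insert x S \<Longrightarrow> T \<le> t \<Longrightarrow> dist (\<Phi> t q) z < \<epsilon> (\<Phi> t q) \<Longrightarrow> z \<in> S"
  obtains q t where "q \<in> insert x S" "T \<le> t" "dist (\<Phi> t q) y < \<epsilon> (\<Phi> t q)"
proof -
  obtain k p t where *: "1 \<le> k" "p 0 = x" "p k = y"
    "\<And>j. j < k \<Longrightarrow> T \<le> t j \<and> dist (\<Phi> (t j) (p j)) (p (Suc j)) < \<epsilon> (\<Phi> (t j) (p j))"
    using assms(1) unfolding chain_from_to_def by blast
  have "p j \<in> insert x S" if "j \<le> k" for j
    using that
  proof (induction j)
    case (Suc j)
    then show ?case
      using step[of "p j" "t j" "p (Suc j)"] *(4)[of j] by auto
  qed (simp add: *)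
  then have "p (k - 1) \<in> insert x S"
    by simp
  with *(4)[of "k - 1"] *(1,3) that show thesis
    by auto
qed

section \<open>Lyapunov functions of absorbing sets\<close>

text \<open>The radius is evaluated at the image point, as in a chain step, so no
  \<open>(\<epsilon>, T)\<close>-chain that starts in \<open>U\<close> can leave
  \<open>U\<close>.\<close>

definition absorbing :: "('a::metric_space \<Rightarrow> 'a) \<Rightarrow> ('a \<Rightarrow> real) \<Rightarrow> nat \<Rightarrow> 'a set \<Rightarrow> bool" where
  "absorbing \<phi> \<epsilon> T U \<longleftrightarrow>
     (\<forall>q\<in>U. \<forall>t\<ge>T. ball (iterates \<phi> t q) (\<epsilon> (iterates \<phi> t q)) \<subseteq> U)"

definition late_image :: "('a::metric_space \<Rightarrow> 'a) \<Rightarrow> nat \<Rightarrow> 'a set \<Rightarrow> 'a set" where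
  "late_image \<phi> T U = closure (\<Union>t\<in>{T..}. iterates \<phi> t ` U)"

definition chain_reachable :: "('a::metric_space \<Rightarrow> 'a) \<Rightarrow> ('a \<Rightarrow> real) \<Rightarrow> nat \<Rightarrow> 'a \<Rightarrow> 'a set" where
  "chain_reachable \<phi> \<epsilon> T x = {y. chain_from_to (iterates \<phi>) \<epsilon> T x y}"

lemma absorbingD:
  assumes "absorbing \<phi> \<epsilon> T U" "q \<in> U" "T \<le> t"
    and "dist (iterates \<phi> t q) z < \<epsilon> (iterates \<phi> t q)"
  shows "z \<in> U"
proof -
  have "ball (iterates \<phi> t q) (\<epsilon> (iterates \<phi> t q)) \<subseteq> U"
    using assms(1-3) by (simp add: absorbing_def)
  with assms(4) show ?thesis
    by auto
qed

lemma absorbing_chain_reachable: "absorbing \<phi> \<epsilon> T (chain_reachable \<phi> \<epsilon> T x)"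
  unfolding absorbing_def chain_reachable_def by (auto intro: chain_append)

lemma iterates_in_chain_reachable:
  assumes "error_function \<epsilon>" "T \<le> t"
  shows "iterates \<phi> t x \<in> chain_reachable \<phi> \<epsilon> T x"
  using assms chain_single[of T t "iterates \<phi>" x _ \<epsilon>]
  by (simp add: chain_reachable_def error_function_def)

text \<open>The endpoint of a chain can be moved within the ball that its last step allows, and the
  result is still a chain.\<close>

lemma open_chain_reachable: "open (chain_reachable \<phi> \<epsilon> T x)"
proof -
  define U where "U = chain_reachable \<phi> \<epsilon> T x"
  have "\<exists>V. open V \<and> y \<in> V \<and> V \<subseteq> U" if "y \<in> U" for y
  proof -
    have "chain_from_to (iterates \<phi>) \<epsilon> T x y"
      using that by (simp add: U_def chain_reachable_def)
    then obtain q t where q: "q \<in> insert x U" "T \<le> t"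
      "dist (iterates \<phi> t q) y < \<epsilon> (iterates \<phi> t q)"
      by (rule chain_last_step[where S = U])
        (auto simp: U_def chain_reachable_def intro: chain_append chain_single)
    have "ball (iterates \<phi> t q) (\<epsilon> (iterates \<phi> t q)) \<subseteq> U"
      using q(1,2) by (auto simp: U_def chain_reachable_def intro: chain_append chain_single)
    with q(3) show ?thesis
      by (metis mem_ball open_ball)
  qed
  then show ?thesis
    unfolding U_def[symmetric] by (subst open_subopen) blast
qed

lemma iterates_in_late_image:
  assumes "q \<in> U" "T \<le> t"
  shows "iterates \<phi> t q \<in> late_image \<phi> T U"
  unfolding late_image_def using assms by (intro closure_subset[THEN subsetD]) auto

lemma late_image_subset:
  assumes \<epsilon>: "error_function \<epsilon>" and U: "absorbing \<phi> \<epsilon> T U"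
  shows "late_image \<phi> T U \<subseteq> U"
proof
  fix z assume z: "z \<in> late_image \<phi> T U"
  \<comment> \<open>The radius in \<open>absorbing\<close> is evaluated at the late image, not at
    \<open>z\<close>. On the neighbourhood \<open>D\<close> of \<open>z\<close> it exceeds
    \<open>\<epsilon> z / 2\<close>, which in turn exceeds the distance to \<open>z\<close>.\<close>
  define D where "D = {w. \<epsilon> z / 2 < \<epsilon> w} \<inter> ball z (\<epsilon> z / 2)"
  have "continuous_on UNIV \<epsilon>" "0 < \<epsilon> z"
    using \<epsilon> by (simp_all add: error_function_def)
  moreover from this have "open {w. \<epsilon> z / 2 < \<epsilon> w}"
    by (intro open_Collect_less continuous_on_const)
  ultimately have "open D" "z \<in> D"
    by (simp_all add: D_def open_Int)
  then have "D \<inter> (\<Union>t\<in>{T..}. iterates \<phi> t ` U) \<noteq> {}"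
    using z unfolding late_image_def by (metis IntI empty_iff open_Int_closure_eq_empty)
  then obtain t q where *: "q \<in> U" "T \<le> t" "iterates \<phi> t q \<in> D"
    by auto
  then have "dist (iterates \<phi> t q) z < \<epsilon> (iterates \<phi> t q)"
    by (simp add: D_def dist_commute)
  with U *(1,2) show "z \<in> U"
    by (rule absorbingD)
qed

lemma iterates_late_image:
  assumes \<phi>: "continuous_on UNIV \<phi>" and z: "z \<in> late_image \<phi> T U"
  shows "iterates \<phi> n z \<in> late_image \<phi> T U"
proof -
  have "iterates \<phi> n ` (\<Union>t\<in>{T..}. iterates \<phi> t ` U) \<subseteq> (\<Union>t\<in>{T..}. iterates \<phi> t ` U)"
    by (force simp: iterates_add)
  then have "iterates \<phi> n ` late_image \<phi> T U \<subseteq> late_image \<phi> T U"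
    unfolding late_image_def
    by (rule image_closure_subset[OF continuous_on_subset[OF continuous_on_iterates[OF \<phi>] subset_UNIV]
          closed_closure order.trans[OF _ closure_subset]])
  with z show ?thesis
    by blast
qed

text \<open>If the steps are long and the errors small, every step jumps from a late image of
  \<open>U\<close>, so the last one ends close to such an image. Taking \<open>y = x\<close> locates
  the chain recurrent points whose orbits meet \<open>U\<close>.\<close>

lemma chain_into_late_image:
  assumes \<epsilon>: "error_function \<epsilon>" and T: "0 < T" and U: "absorbing \<phi> \<epsilon> T U"
    and x: "iterates \<phi> n x \<in> U"
    and xy: "\<And>\<delta> S. error_function \<delta> \<Longrightarrow> 0 < S \<Longrightarrow> chain_from_to (iterates \<phi>) \<delta> S x y"
  shows "y \<in> late_image \<phi> T U"
  unfolding late_image_def closure_approachable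
proof (intro allI impI)
  fix c :: real assume c: "0 < c"
  \<comment> \<open>The bound \<open>\<epsilon>\<close> keeps the chain in \<open>U\<close> after
    its first step; the bound \<open>c\<close> puts \<open>y\<close> within \<open>c\<close> of a
    late image.\<close>
  define \<delta> where "\<delta> = (\<lambda>z. min (\<epsilon> z) c)"
  have "error_function \<delta>"
    using \<epsilon> c by (simp add: \<delta>_def error_function_def continuous_on_min)
  then have chain: "chain_from_to (iterates \<phi>) \<delta> (T + n) x y"
    using T xy by simp
  have late: "\<exists>r s. r \<in> U \<and> T \<le> s \<and> iterates \<phi> t q = iterates \<phi> s r"
    if "q \<in> insert x U" "T + n \<le> t" for q t
  proof (cases "q \<in> U")
    case True
    with that(2) show ?thesis
      by (intro exI[of _ q] exI[of _ t]) simp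
  next
    case False
    with that x show ?thesis
      by (intro exI[of _ "iterates \<phi> n x"] exI[of _ "t - n"]) (simp add: iterates_add)
  qed
  have "z \<in> U"
    if q: "q \<in> insert x U" "T + n \<le> t" and z: "dist (iterates \<phi> t q) z < \<delta> (iterates \<phi> t q)"
    for q t z
  proof -
    obtain r s where rs: "r \<in> U" "T \<le> s" "iterates \<phi> t q = iterates \<phi> s r"
      using late[OF q] by (elim exE conjE)
    show ?thesis
      by (rule absorbingD[OF U rs(1,2)]) (use z rs(3) in \<open>simp add: \<delta>_def\<close>)
  qed
  from chain this obtain q t where q: "q \<in> insert x U" "T + n \<le> t"
    and y: "dist (iterates \<phi> t q) y < \<delta> (iterates \<phi> t q)"
    by (rule chain_last_step)
  obtain r s where rs: "r \<in> U" "T \<le> s" "iterates \<phi> t q = iterates \<phi> s r"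
    using late[OF q] by (elim exE conjE)
  show "\<exists>w\<in>\<Union>t\<in>{T..}. iterates \<phi> t ` U. dist w y < c"
  proof
    show "dist (iterates \<phi> s r) y < c"
      using y by (simp add: \<delta>_def rs(3))
    show "iterates \<phi> s r \<in> (\<Union>t\<in>{T..}. iterates \<phi> t ` U)"
      using rs(1,2) by (intro UN_I[of s] imageI) simp_all
  qed
qed

text \<open>Values strictly between 0 and 1 are possible only off the chain recurrent set; on it,
  0-1 values allow a weighted series to be decoded. One function need not tell all chain classes
  apart, hence the single implication at the end.\<close>

definition class_indicator :: "('a::metric_space \<Rightarrow> 'a) \<Rightarrow> ('a \<Rightarrow> real) \<Rightarrow> bool" where
  "class_indicator \<phi> H \<longleftrightarrow>
     continuous_on UNIV H \<and> (\<forall>x. H x \<in> {0..1}) \<and> (\<forall>x. H (\<phi> x) \<le> H x) \<and>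
     (\<forall>x\<in>chain_recurrent_set (iterates \<phi>). H x \<in> {0, 1} \<and> (\<forall>t. H (iterates \<phi> t x) = H x)) \<and>
     (\<forall>x\<in>chain_recurrent_set (iterates \<phi>). \<forall>y\<in>chain_recurrent_set (iterates \<phi>).
        chain_equivalent (iterates \<phi>) x y \<longrightarrow> H x = H y)"

text \<open>On chain recurrent points the composition changes nothing. Elsewhere it moves a drop of
  \<open>H\<close> further along an orbit back to the first step.\<close>

lemma class_indicator_iterates:
  assumes \<phi>: "continuous_on UNIV \<phi>" and H: "class_indicator \<phi> H"
  shows "class_indicator \<phi> (\<lambda>x. H (iterates \<phi> n x))"
proof -
  have "continuous_on UNIV (\<lambda>x. H (iterates \<phi> n x))"
    using H continuous_on_iterates[OF \<phi>, of n] unfolding class_indicator_def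
    by (metis continuous_on_compose2 subset_UNIV)
  moreover have "H (iterates \<phi> n (\<phi> x)) \<le> H (iterates \<phi> n x)" for x
    using H by (simp add: class_indicator_def iterates_def flip: funpow_swap1)
  ultimately show ?thesis
    using H unfolding class_indicator_def iterates_add by auto
qed

lemma absorbing_class_indicator:
  assumes \<phi>: "continuous_on UNIV \<phi>" and \<epsilon>: "error_function \<epsilon>" and T: "0 < T"
    and U: "absorbing \<phi> \<epsilon> T U" and "open U"
  shows "\<exists>H. class_indicator \<phi> H \<and> (\<forall>z. z \<notin> U \<longrightarrow> H z = 1) \<and>
    (\<forall>z\<in>late_image \<phi> T U. H z = 0)"
proof -
  define C where "C = late_image \<phi> T U"
  have C: "C \<subseteq> U" "closed C" "\<And>z n. z \<in> C \<Longrightarrow> iterates \<phi> n z \<in> C"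
    using late_image_subset[OF \<epsilon> U] iterates_late_image[OF \<phi>]
    by (auto simp: C_def late_image_def)
  obtain f where "continuous_map euclidean (top_of_set {0..1::real}) f"
    and f0: "f ` (- U) \<subseteq> {0}" and f1: "f ` C \<subseteq> {1}"
  proof (rule Urysohn_lemma[of euclidean "- U" C 0 1])
    show "normal_space (euclidean :: 'a topology)"
      by (simp add: metrizable_imp_normal_space metrizable_space_euclidean)
  qed (use C \<open>open U\<close> in \<open>auto simp: disjnt_def\<close>)
  then have f: "continuous_on UNIV f" "\<And>x. 0 \<le> f x" "\<And>x. f x \<le> 1"
    by (auto simp: continuous_map_in_subtopology)
  have f0: "f x = 0" if "x \<notin> U" for x
    using f0 that by auto
  have f1: "f x = 1" if "x \<in> C" for x
    using f1 that by auto
  \<comment> \<open>Being absorbing says nothing about times below \<open>T\<close>, so for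
    \<open>T > 1\<close> the function \<open>f\<close> alone may decrease along an orbit. A window
    of \<open>T\<close> consecutive factors repairs this.\<close>
  define P where "P x = (\<Prod>i<T. f (iterates \<phi> i x))" for x
  have P0: "P x = 0" if "x \<notin> U" for x
  proof -
    have "f (iterates \<phi> 0 x) = 0"
      using f0 that by simp
    then show ?thesis
      unfolding P_def using T by (intro prod_zero bexI[of _ 0]) auto
  qed
  have P1: "P x = 1" if "x \<in> C" for x
    using that by (simp add: P_def f1 C)
  have P01: "0 \<le> P x" "P x \<le> 1" for x
    by (auto simp: P_def f intro: prod_nonneg prod_le_1)
  \<comment> \<open>Passing from \<open>x\<close> to \<open>\<phi> x\<close> removes the factor
    \<open>f x\<close> and adds the factor at \<open>iterates \<phi> T x\<close>, a point of
    \<open>C\<close> if \<open>x\<close> is in \<open>U\<close>.\<close>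
  have mono: "P x \<le> P (\<phi> x)" for x
  proof (cases "x \<in> U")
    case True
    obtain S where S: "T = Suc S"
      using T by (cases T) auto
    have "f (iterates \<phi> T x) = 1"
      using True by (intro f1) (simp add: C_def iterates_in_late_image)
    then have "P (\<phi> x) = (\<Prod>i<S. f (iterates \<phi> (Suc i) x))"
      by (simp add: P_def S iterates_Suc)
    moreover have "P x = f x * (\<Prod>i<S. f (iterates \<phi> (Suc i) x))"
      unfolding P_def S by (subst prod.lessThan_Suc_shift) simp
    moreover have "0 \<le> (\<Prod>i<S. f (iterates \<phi> (Suc i) x))"
      by (auto intro: prod_nonneg f)
    ultimately show ?thesis
      using f(2,3)[of x] by (simp add: mult_left_le_one_le)
  qed (simp add: P0 P01)
  have "continuous_on UNIV P"
    unfolding P_def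
    using f(1) continuous_on_iterates[OF \<phi>]
    by (intro continuous_on_prod) (metis continuous_on_compose2 subset_UNIV)
  have rec: "x \<in> C" if "x \<in> chain_recurrent_set (iterates \<phi>)" "iterates \<phi> n x \<in> U" for x n
    unfolding C_def using that
    by (intro chain_into_late_image[OF \<epsilon> T U]) (auto simp: chain_recurrent_set_def)
  have P_rec: "P x \<in> {0, 1} \<and> P (iterates \<phi> t x) = P x"
    if "x \<in> chain_recurrent_set (iterates \<phi>)" for x t
  proof (cases "x \<in> C")
    case True
    then show ?thesis
      by (simp add: P1 C)
  next
    case False
    \<comment> \<open>By \<open>rec\<close>, the orbit of a chain recurrent point outside
      \<open>C\<close> never meets \<open>U\<close>.\<close>
    then have "x \<notin> U" "iterates \<phi> t x \<notin> U"
      using rec[OF that, of 0] rec[OF that, of t] by auto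
    then show ?thesis
      by (simp add: P0)
  qed
  \<comment> \<open>If one of the points is in \<open>U\<close>, the other is in \<open>C\<close>,
    hence in \<open>U\<close>, which puts the first in \<open>C\<close> as well. Otherwise both are
    outside \<open>U\<close>.\<close>
  have P_equiv: "P x = P y" if xy: "chain_equivalent (iterates \<phi>) x y" for x y
  proof -
    have "y \<in> C" if "x \<in> U"
      unfolding C_def using xy that
      by (intro chain_into_late_image[OF \<epsilon> T U, of 0 x]) (auto simp: chain_equivalent_def)
    moreover have "x \<in> C" if "y \<in> U"
      unfolding C_def using xy that
      by (intro chain_into_late_image[OF \<epsilon> T U, of 0 y]) (auto simp: chain_equivalent_def)
    ultimately show ?thesis
      using P0 P1 C(1) by (metis subsetD)
  qed
  have "class_indicator \<phi> (\<lambda>x. 1 - P x)"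
    unfolding class_indicator_def
  proof (intro conjI allI ballI impI)
    show "continuous_on UNIV (\<lambda>x. 1 - P x)"
      using \<open>continuous_on UNIV P\<close> by (intro continuous_intros)
  next
    fix x assume x: "x \<in> chain_recurrent_set (iterates \<phi>)"
    show "1 - P x \<in> {0, 1}" "\<And>t. 1 - P (iterates \<phi> t x) = 1 - P x"
      using P_rec[OF x] by auto
  next
    fix x y assume "chain_equivalent (iterates \<phi>) x y"
    from P_equiv[OF this] show "1 - P x = 1 - P y"
      by simp
  qed (simp_all add: P01 mono)
  then show ?thesis
    using P0 P1 unfolding C_def by (intro exI[of _ "\<lambda>x. 1 - P x"]) simp
qed

section \<open>Separation of points by class indicators\<close>

lemma class_indicator_separates_orbit:
  assumes \<phi>: "continuous_on UNIV \<phi>" and x: "x \<notin> chain_recurrent_set (iterates \<phi>)"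
  shows "\<exists>H. class_indicator \<phi> H \<and> H x \<noteq> H (\<phi> x)"
proof -
  obtain \<epsilon> T where \<epsilon>: "error_function \<epsilon>" and T: "0 < T"
    and "\<not> chain_from_to (iterates \<phi>) \<epsilon> T x x"
    using x by (auto simp: chain_recurrent_set_def)
  then have x: "x \<notin> chain_reachable \<phi> \<epsilon> T x"
    by (simp add: chain_reachable_def)
  \<comment> \<open>Since \<open>x\<close> itself is not reachable from \<open>x\<close>, time
    \<open>T\<close> is spent on entering the reachable set and another \<open>T\<close> on reaching
    its late image.\<close>
  have late: "iterates \<phi> (T + T) x \<in> late_image \<phi> T (chain_reachable \<phi> \<epsilon> T x)"
    unfolding iterates_add[symmetric]
    by (intro iterates_in_late_image iterates_in_chain_reachable \<epsilon> order.refl)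
  obtain H where H: "class_indicator \<phi> H"
    "\<forall>z. z \<notin> chain_reachable \<phi> \<epsilon> T x \<longrightarrow> H z = 1"
    "\<forall>z\<in>late_image \<phi> T (chain_reachable \<phi> \<epsilon> T x). H z = 0"
    using absorbing_class_indicator[OF \<phi> \<epsilon> T absorbing_chain_reachable open_chain_reachable]
    by blast
  have Hx: "H x = 1" "H (iterates \<phi> (T + T) x) = 0"
    by (rule H(2)[rule_format, OF x], rule H(3)[rule_format, OF late])
  \<comment> \<open>\<open>H\<close> falls from 1 to 0 between \<open>x\<close> and its iterate at
    time \<open>T + T\<close>, but perhaps not at the first step; composition with
    \<open>iterates \<phi> n\<close> shifts the change to \<open>x\<close>.\<close>
  have "\<exists>n. H (iterates \<phi> n x) \<noteq> H (iterates \<phi> (Suc n) x)"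
  proof (rule ccontr)
    assume "\<not> ?thesis"
    then have step: "H (iterates \<phi> (Suc n) x) = H (iterates \<phi> n x)" for n
      by metis
    have "H (iterates \<phi> n x) = H x" for n
      by (induction n) (simp_all add: step)
    from this[of "T + T"] Hx show False
      by simp
  qed
  then obtain n where "H (iterates \<phi> n x) \<noteq> H (iterates \<phi> n (\<phi> x))"
    unfolding iterates_Suc by blast
  with class_indicator_iterates[OF \<phi> H(1), of n] show ?thesis
    by (intro exI[of _ "\<lambda>x. H (iterates \<phi> n x)"] conjI)
qed

lemma class_indicator_separates_classes:
  assumes \<phi>: "continuous_on UNIV \<phi>" and x: "x \<in> chain_recurrent_set (iterates \<phi>)"
    and y: "y \<in> chain_recurrent_set (iterates \<phi>)" and xy: "\<not> chain_equivalent (iterates \<phi>) x y"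
  shows "\<exists>H. class_indicator \<phi> H \<and> H x \<noteq> H y"
proof -
  \<comment> \<open>Inequivalence may come from a missing chain in either direction, so the claim is
    made for an ordered pair \<open>a\<close>, \<open>b\<close>.\<close>
  have *: "\<exists>H. class_indicator \<phi> H \<and> H a \<noteq> H b"
    if \<epsilon>: "error_function \<epsilon>" and T: "0 < T" and "\<not> chain_from_to (iterates \<phi>) \<epsilon> T a b"
      and a: "a \<in> chain_recurrent_set (iterates \<phi>)" for \<epsilon> T a b
  proof -
    have b: "b \<notin> chain_reachable \<phi> \<epsilon> T a"
      using that by (simp add: chain_reachable_def)
    \<comment> \<open>Recurrence makes \<open>a\<close> reachable from itself, so time
      \<open>T\<close> suffices. Constancy along the orbit then carries the value 0 back to
      \<open>a\<close>.\<close>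
    have late: "iterates \<phi> T a \<in> late_image \<phi> T (chain_reachable \<phi> \<epsilon> T a)"
      using a \<epsilon> T by (intro iterates_in_late_image)
        (auto simp: chain_reachable_def chain_recurrent_set_def)
    obtain H where H: "class_indicator \<phi> H"
      "\<forall>z. z \<notin> chain_reachable \<phi> \<epsilon> T a \<longrightarrow> H z = 1"
      "\<forall>z\<in>late_image \<phi> T (chain_reachable \<phi> \<epsilon> T a). H z = 0"
      using absorbing_class_indicator[OF \<phi> \<epsilon> T absorbing_chain_reachable open_chain_reachable]
      by blast
    have "H (iterates \<phi> T a) = H a"
      using H(1) a by (simp add: class_indicator_def)
    then have "H a \<noteq> H b"
      using H(2)[rule_format, OF b] H(3)[rule_format, OF late] by simp
    with H(1) show ?thesis
      by (intro exI[of _ H] conjI)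
  qed
  obtain \<epsilon> T where \<epsilon>T: "error_function \<epsilon>" "0 < T"
    and "\<not> chain_from_to (iterates \<phi>) \<epsilon> T x y \<or> \<not> chain_from_to (iterates \<phi>) \<epsilon> T y x"
    using xy unfolding chain_equivalent_def by blast
  then show ?thesis
  proof (elim disjE)
    assume "\<not> chain_from_to (iterates \<phi>) \<epsilon> T x y"
    from *[OF \<epsilon>T this x] show ?thesis .
  next
    assume "\<not> chain_from_to (iterates \<phi>) \<epsilon> T y x"
    from *[OF \<epsilon>T this y] obtain H where "class_indicator \<phi> H" "H y \<noteq> H x"
      by (elim exE conjE)
    then show ?thesis
      by (intro exI[of _ H]) simp
  qed
qed

section \<open>Combining countably many functions\<close>

text \<open>If \<open>H\<close> separates \<open>x\<close> from \<open>y\<close>, it separates every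
  point near \<open>x\<close> from every point near \<open>y\<close>. One function is chosen for
  each pair of balls, taken from a countable base, that some member of \<open>F\<close>
  separates.\<close>

lemma countable_separating_subfamily:
  fixes F :: "('a::metric_space \<Rightarrow> 'b::t2_space) set"
  assumes sep: "separable_space (euclidean :: 'a topology)"
    and cont: "\<And>H. H \<in> F \<Longrightarrow> continuous_on UNIV H"
  obtains G where "countable G" "G \<subseteq> F"
    "\<And>H x y. H \<in> F \<Longrightarrow> H x \<noteq> H y \<Longrightarrow> \<exists>h\<in>G. h x \<noteq> h y"
proof -
  obtain D :: "'a set" where D: "countable D" "closure D = UNIV"
    using sep by (auto simp: separable_space_def)
  define r where "r n = 1 / real (Suc n)" for n
  define good where "good d e n H \<longleftrightarrow>
    H \<in> F \<and> (\<forall>x\<in>ball d (r n). \<forall>y\<in>ball e (r n). H x \<noteq> H y)" for d e n H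
  \<comment> \<open>The choice in \<open>pick\<close> is meaningful only for indices in
    \<open>I\<close>.\<close>
  define I where "I = {i \<in> D \<times> D \<times> UNIV. case i of (d, e, n) \<Rightarrow> \<exists>H. good d e n H}"
  define pick where "pick i = (case i of (d, e, n) \<Rightarrow> SOME H. good d e n H)" for i
  have pick: "good d e n (pick (d, e, n))" if "(d, e, n) \<in> I" for d e n
  proof -
    have "\<exists>H. good d e n H"
      using that by (simp add: I_def)
    then show ?thesis
      unfolding pick_def prod.case by (rule someI_ex)
  qed
  show thesis
  proof
    have "countable I"
      unfolding I_def using D(1) by (intro countable_subset[OF Collect_restrict]) auto
    then show "countable (pick ` I)"
      by simp
    show "pick ` I \<subseteq> F"
      using pick by (auto simp: good_def)
  next
    fix H x y assume H: "H \<in> F" "H x \<noteq> H y"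
    obtain A B where AB: "open A" "open B" "H x \<in> A" "H y \<in> B" "A \<inter> B = {}"
      using hausdorff[OF H(2)] by blast
    have "open (H -` A)" "open (H -` B)"
      using cont[OF H(1)] AB by (auto intro: open_vimage)
    moreover have "x \<in> H -` A" "y \<in> H -` B"
      using AB by auto
    ultimately obtain a b where ab: "0 < a" "ball x a \<subseteq> H -` A" "0 < b" "ball y b \<subseteq> H -` B"
      by (meson open_contains_ball)
    \<comment> \<open>A ball of radius \<open>r n\<close> that contains \<open>x\<close> has all its
      points within \<open>2 * r n < a\<close> of \<open>x\<close>; likewise for \<open>y\<close>
      and \<open>b\<close>.\<close>
    obtain n where n: "r n < min a b / 2"
      using reals_Archimedean[of "min a b / 2"] ab by (auto simp: r_def inverse_eq_divide)
    have "0 < r n"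
      by (simp add: r_def)
    have dense: "\<exists>d\<in>D. dist d z < r n" for z
      using D(2) \<open>0 < r n\<close> closure_approachable[of z D] by auto
    obtain d e where de: "d \<in> D" "dist d x < r n" "e \<in> D" "dist e y < r n"
      using dense by meson
    have "ball d (r n) \<subseteq> ball x a"
    proof
      fix w assume "w \<in> ball d (r n)"
      then show "w \<in> ball x a"
        using dist_triangle[of x w d] de n by (simp add: dist_commute)
    qed
    moreover have "ball e (r n) \<subseteq> ball y b"
    proof
      fix w assume "w \<in> ball e (r n)"
      then show "w \<in> ball y b"
        using dist_triangle[of y w e] de n by (simp add: dist_commute)
    qed
    ultimately have "ball d (r n) \<subseteq> H -` A" "ball e (r n) \<subseteq> H -` B"
      using ab by auto
    then have "H u \<in> A" "H v \<in> B" if "u \<in> ball d (r n)" "v \<in> ball e (r n)" for u v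
      using that by (meson subsetD vimageD)+
    then have "good d e n H"
      using H(1) AB(5) unfolding good_def by (metis disjoint_iff)
    then have i: "(d, e, n) \<in> I"
      using de(1,3) by (auto simp: I_def)
    then have "pick (d, e, n) x \<noteq> pick (d, e, n) y"
      using pick[OF i] de(2,4) unfolding good_def by simp
    with i show "\<exists>h\<in>pick ` I. h x \<noteq> h y"
      by blast
  qed
qed

section \<open>Series with weights \<open>(1/3) ^ n\<close>\<close>

lemma summable_ternary:
  fixes a :: "nat \<Rightarrow> real"
  assumes "\<And>n. a n \<in> {0..1}"
  shows "summable (\<lambda>n. (1/3) ^ n * a n)"
  by (rule summable_comparison_test'[where g = "\<lambda>n. (1/3) ^ n" and N = 0])
    (use assms in \<open>auto simp: abs_mult intro: mult_left_le\<close>)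

lemma ternary_bounds:
  fixes a :: "nat \<Rightarrow> real"
  assumes a: "\<And>n. a n \<in> {0..1}"
  shows "(\<Sum>n. (1/3) ^ n * a n) \<in> {0..3/2}"
proof -
  have "(\<Sum>n. (1/3) ^ n * a n) \<le> (\<Sum>n. (1/3::real) ^ n)"
    by (rule suminf_le) (use a summable_ternary[OF a] in \<open>auto intro: mult_left_le\<close>)
  also have "\<dots> = 3/2"
    by (simp add: suminf_geometric)
  finally show ?thesis
    using a by (auto intro!: suminf_nonneg summable_ternary)
qed

lemma ternary_split_head:
  fixes a :: "nat \<Rightarrow> real"
  assumes a: "\<And>n. a n \<in> {0..1}"
  shows "(\<Sum>n. (1/3) ^ n * a n) = a 0 + (\<Sum>n. (1/3) ^ n * a (Suc n)) / 3"
proof -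
  have "(\<Sum>n. (1/3) ^ Suc n * a (Suc n)) = (\<Sum>n. (1/3) ^ n * a (Suc n) / 3)"
    by simp
  also have "\<dots> = (\<Sum>n. (1/3) ^ n * a (Suc n)) / 3"
    by (rule suminf_divide[OF summable_ternary]) (rule a)
  moreover have "(\<Sum>n. (1/3) ^ Suc n * a (Suc n)) = (\<Sum>n. (1/3) ^ n * a n) - (1/3) ^ 0 * a 0"
    by (rule suminf_split_head[OF summable_ternary]) (rule a)
  ultimately show ?thesis
    by simp
qed

text \<open>The terms after the first add up to a number in \<open>{0..1/2}\<close>, which cannot
  compensate a difference of 1 in the first digit. Equal sums thus have equal first digits and equal
  shifted sums, and induction proceeds on the shifts.\<close>

lemma ternary_inj:
  fixes a b :: "nat \<Rightarrow> real"
  assumes "\<And>n. a n \<in> {0, 1}" "\<And>n. b n \<in> {0, 1}"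
    and "(\<Sum>n. (1/3) ^ n * a n) = (\<Sum>n. (1/3) ^ n * b n)"
  shows "a n = b n"
proof -
  have head: "a 0 = b 0 \<and> (\<Sum>n. (1/3) ^ n * a (Suc n)) = (\<Sum>n. (1/3) ^ n * b (Suc n))"
    if ab: "\<And>n. a n \<in> {0, 1}" "\<And>n. b n \<in> {0, 1}"
      and eq: "(\<Sum>n. (1/3) ^ n * a n) = (\<Sum>n. (1/3) ^ n * b n)" for a b :: "nat \<Rightarrow> real"
  proof -
    have a01: "a n \<in> {0..1}" and b01: "b n \<in> {0..1}" for n
      using ab[of n] by auto
    have "a 0 + (\<Sum>n. (1/3) ^ n * a (Suc n)) / 3 = b 0 + (\<Sum>n. (1/3) ^ n * b (Suc n)) / 3"
      using eq by (simp only: ternary_split_head[of a, OF a01] ternary_split_head[of b, OF b01])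
    moreover have "(\<Sum>n. (1/3) ^ n * a (Suc n)) \<in> {0..3/2}" "(\<Sum>n. (1/3) ^ n * b (Suc n)) \<in> {0..3/2}"
      by (rule ternary_bounds, rule a01) (rule ternary_bounds, rule b01)
    ultimately show ?thesis
      using ab(1)[of 0] ab(2)[of 0] by auto
  qed
  show ?thesis
    using assms
  proof (induction n arbitrary: a b)
    case 0
    then show ?case
      using head by blast
  next
    case (Suc n)
    have "(\<Sum>n. (1/3) ^ n * a (Suc n)) = (\<Sum>n. (1/3) ^ n * b (Suc n))"
      using head[OF Suc.prems] by blast
    then show ?case
      by (rule Suc.IH[of "\<lambda>n. a (Suc n)" "\<lambda>n. b (Suc n)", rotated 2]) (rule Suc.prems)+
  qed
qed

lemma continuous_on_ternary:
  fixes h :: "nat \<Rightarrow> 'a::topological_space \<Rightarrow> real"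
  assumes h: "\<And>n. continuous_on S (h n)" and h01: "\<And>n x. x \<in> S \<Longrightarrow> h n x \<in> {0..1}"
  shows "continuous_on S (\<lambda>x. \<Sum>n. (1/3) ^ n * h n x)"
proof (rule uniform_limit_theorem)
  show "uniform_limit S (\<lambda>n x. \<Sum>i<n. (1/3) ^ i * h i x) (\<lambda>x. \<Sum>n. (1/3) ^ n * h n x) sequentially"
    by (rule Weierstrass_m_test[where M = "\<lambda>n. (1/3) ^ n"])
      (use h01 in \<open>auto simp: abs_mult intro: mult_left_le\<close>)
qed (auto intro!: always_eventually continuous_on_sum continuous_on_mult continuous_on_const h)

section \<open>The Lyapunov function as a weighted series of class indicators\<close>

theorem theorem5p14:
  fixes \<phi> :: "'a::metric_space \<Rightarrow> 'a"
  assumes "separable_space (euclidean :: 'a topology)"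
    and "continuous_on UNIV \<phi>"
  shows "\<exists>L :: 'a \<Rightarrow> real. complete_lyapunov_function (iterates \<phi>) L"
proof -
  let ?R = "chain_recurrent_set (iterates \<phi>)"
  have cont: "continuous_on UNIV H" if "H \<in> Collect (class_indicator \<phi>)" for H
    using that by (simp add: class_indicator_def)
  obtain G where G: "countable G" "G \<subseteq> Collect (class_indicator \<phi>)"
    and sep: "\<And>H x y. class_indicator \<phi> H \<Longrightarrow> H x \<noteq> H y \<Longrightarrow> \<exists>h\<in>G. h x \<noteq> h y"
    using countable_separating_subfamily[OF assms(1) cont] by (metis mem_Collect_eq)
  \<comment> \<open>\<open>from_nat_into\<close> enumerates only nonempty sets.\<close>
  define h where "h = from_nat_into (insert (\<lambda>_. 0) G)"
  have range_h: "range h = insert (\<lambda>_. 0) G"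
    unfolding h_def using G(1) by (intro range_from_nat_into) auto
  have "class_indicator \<phi> (\<lambda>_. 0)"
    by (simp add: class_indicator_def)
  then have h: "class_indicator \<phi> (h n)" for n
    using G(2) range_h by (metis insertE mem_Collect_eq rangeI subsetD)
  have sep: "\<exists>n. h n x \<noteq> h n y" if "class_indicator \<phi> H" "H x \<noteq> H y" for H x y
    using sep[OF that] range_h by (metis imageE insertI2)
  have h_cont: "\<And>n. continuous_on UNIV (h n)"
    and h01: "\<And>n x. h n x \<in> {0..1}"
    and h_mono: "\<And>n x. h n (\<phi> x) \<le> h n x"
    and h_rec: "\<And>n x. x \<in> ?R \<Longrightarrow> h n x \<in> {0, 1}"
    and h_orbit: "\<And>n x t. x \<in> ?R \<Longrightarrow> h n (iterates \<phi> t x) = h n x"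
    and h_equiv: "\<And>n x y. x \<in> ?R \<Longrightarrow> y \<in> ?R \<Longrightarrow> chain_equivalent (iterates \<phi>) x y \<Longrightarrow> h n x = h n y"
    using h unfolding class_indicator_def by blast+
  \<comment> \<open>The factor \<open>2/3\<close> is the reciprocal of the bound in
    \<open>ternary_bounds\<close>, so \<open>L\<close> stays in the unit interval.\<close>
  define L where "L x = (2/3) * (\<Sum>n. (1/3) ^ n * h n x)" for x
  have summable_h: "summable (\<lambda>n. (1/3) ^ n * h n x)" for x
    by (rule summable_ternary[OF h01])
  have L_step: "L (\<phi> x) \<le> L x" for x
    unfolding L_def using h_mono by (auto intro!: suminf_le mult_left_mono summable_h)
  have L_decreasing: "L (iterates \<phi> t x) \<le> L (iterates \<phi> s x)" if "s \<le> t" for s t x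
    using lift_Suc_antimono_le[of "\<lambda>t. L (iterates \<phi> t x)" s t] that L_step
    by (simp add: iterates_def)
  have L_strict: "L (\<phi> x) < L x" if x: "x \<notin> ?R" for x
  proof -
    obtain H where "class_indicator \<phi> H" "H x \<noteq> H (\<phi> x)"
      using class_indicator_separates_orbit[OF assms(2) x] by (elim exE conjE)
    then obtain n where "h n x \<noteq> h n (\<phi> x)"
      using sep by blast
    \<comment> \<open>No term of the difference series is negative, by \<open>h_mono\<close>, and
      the term at the obtained \<open>n\<close> is positive.\<close>
    then have "0 < (\<Sum>n. (1/3) ^ n * h n x - (1/3) ^ n * h n (\<phi> x))"
      using h_mono[of n x, THEN le_neq_trans] h_mono summable_h
      by (intro suminf_pos2[of _ n] summable_diff) auto
    then show ?thesis
      by (simp add: L_def suminf_diff[OF summable_h summable_h, symmetric])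
  qed
  have "L (iterates \<phi> t x) < L x" if "x \<notin> ?R" "0 < t" for x t
    using L_decreasing[of 1 t x] L_strict[OF that(1)] that(2) by (simp add: iterates_def)
  moreover have "continuous_on UNIV L"
    unfolding L_def using h_cont h01 by (intro continuous_intros continuous_on_ternary)
  moreover have "L x \<in> {0..1}" for x
    using ternary_bounds[of "\<lambda>n. h n x", OF h01] by (auto simp: L_def)
  moreover have "chain_equivalent (iterates \<phi>) x y \<longleftrightarrow> L x = L y" if xy: "x \<in> ?R" "y \<in> ?R" for x y
  proof
    assume "L x = L y"
    then have eq: "(\<Sum>n. (1/3) ^ n * h n x) = (\<Sum>n. (1/3) ^ n * h n y)"
      by (simp add: L_def)
    \<comment> \<open>On chain recurrent points the sum determines every digit \<open>h n\<close>,
      and the digits separate inequivalent points.\<close>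
    have "h n x = h n y" for n
      by (rule ternary_inj[of "\<lambda>n. h n x" "\<lambda>n. h n y", OF h_rec[OF xy(1)] h_rec[OF xy(2)] eq])
    then show "chain_equivalent (iterates \<phi>) x y"
      using class_indicator_separates_classes[OF assms(2) xy] sep by blast
  qed (use h_equiv[OF xy] in \<open>simp add: L_def\<close>)
  ultimately have "complete_lyapunov_function (iterates \<phi>) L"
    unfolding complete_lyapunov_function_def
    using L_decreasing by (auto simp: L_def h_orbit)
  then show ?thesis
    by (rule exI[of _ L])
qed

end
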